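(* Suppose that $\alpha(x,y)=\frac{x+c_1(y)}{(x+c_1(y))^2+c_2(y)}$ (with $c_2(y)\neq0$ for all $y$), which is of general type. Then the induced metric on a $p$-minimal surface with this $\alpha$ as its $\alpha$-function (in compatible coordinates $(x,y)$) is given by $$a=\frac{|\alpha|\,h(y)}{|x+c_1(y)|\sqrt{1+\alpha^2}},\qquad b=\frac{|\alpha|\,e^{k(y)}}{|x+c_1(y)|\sqrt{1+\alpha^2}},$$ for some functions $h(y)$ and $k(y)$.
   Context: The Heisenberg group $H_1$ is $\mathbb{R}^3$ with the group law $(x_1,y_1,z_1)\circ(x_2,y_2,z_2)=(x_1+x_2,\,y_1+y_2,\,z_1+z_2+y_1x_2-x_1y_2)$. Left invariant fields: $\mathring e_1=\partial_x+y\partial_z$, $\mathring e_2=\partial_y-x\partial_z$, $T=\partial_z$. Contact form $\Theta=dz+x\,dy-y\,dx$, contact bundle $\xi=\ker\Theta$, $J\mathring e_1=\mathring e_2$, $J\mathring e_2=-\mathring e_1$. The adapted metric makes $\mathring e_1,\mathring e_2,T$ orthonormal; $\nabla$ is the connection for which they are parallel. All objects are $C^\infty$. For a surface $\Sigma\subset H_1$ without singular points (points with $T_p\Sigma=\xi_p$) choose a unit field $e_1\in T\Sigma\cap\xi$, $e_2=Je_1$; $H$ is defined by $\nabla_{e_1}e_2=-He_1$; $p$-minimal means $H=0$. The $\alpha$-function is defined by $\alpha e_2+T\in T\Sigma$; $\hat e_1=e_1$, $\hat e_2=\frac{\alpha e_2+T}{\sqrt{1+\alpha^2}}$ is an orthonormal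 frame of $T\Sigma$. Compatible coordinates $(x,y)$: $e_1=\partial_x$; then the induced metric is represented by the functions $a,b$ with $\hat e_2=a\,\partial_x+b\,\partial_y$, coordinates being taken with $b>0$. The quotient $|\alpha|/|x+c_1(y)|$ is understood as $1/|(x+c_1(y))^2+c_2(y)|$ where $x+c_1(y)=0$. Coordinate domains are local, with connected $x$-slices. *)

theory Defs
  imports "HOL-Analysis.Analysis"
begin

section \<open>Smooth maps on open sets\<close>

text \<open>Derivatives are taken at interior points, so these notions are only meant for open \<open>S\<close>.\<close>

primrec Ck_on :: "nat \<Rightarrow> 'a::real_normed_vector set \<Rightarrow> ('a \<Rightarrow> 'b::real_normed_vector) \<Rightarrow> bool" where
  "Ck_on 0 S f \<longleftrightarrow> continuous_on S f"
| "Ck_on (Suc n) S f \<longleftrightarrow> (\<forall>x\<in>S. f differentiable (at x)) \<and>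
     (\<forall>v. Ck_on n S (\<lambda>x. frechet_derivative f (at x) v))"

definition smooth_on :: "'a::real_normed_vector set \<Rightarrow> ('a \<Rightarrow> 'b::real_normed_vector) \<Rightarrow> bool" where
  "smooth_on S f \<longleftrightarrow> (\<forall>n. Ck_on n S f)"


section \<open>The Heisenberg group\<close>

text \<open>Points of the Heisenberg group and tangent vectors (in the coordinate basis
  \<open>\<partial>\<^sub>x, \<partial>\<^sub>y, \<partial>\<^sub>z\<close>) are both elements of \<open>real^3\<close>; the base point of a tangent vector is passed
  as a separate argument.\<close>

definition heis_mult :: "real^3 \<Rightarrow> real^3 \<Rightarrow> real^3" where
  "heis_mult p q = vector [p$1 + q$1, p$2 + q$2, p$3 + q$3 + p$2 * q$1 - p$1 * q$2]"

definition E1 :: "real^3 \<Rightarrow> real^3" where "E1 p = vector [1, 0, p$2]"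
definition E2 :: "real^3 \<Rightarrow> real^3" where "E2 p = vector [0, 1, - p$1]"
definition ET :: "real^3 \<Rightarrow> real^3" where "ET p = vector [0, 0, 1]"

definition contact_form :: "real^3 \<Rightarrow> real^3 \<Rightarrow> real" where
  "contact_form p v = v$3 + p$1 * v$2 - p$2 * v$1"

definition contact_plane :: "real^3 \<Rightarrow> (real^3) set" where
  "contact_plane p = {v. contact_form p v = 0}"

text \<open>Coefficients of a tangent vector in the frame \<open>E1, E2, ET\<close>, and the inverse operation.\<close>

definition frame_coord :: "real^3 \<Rightarrow> real^3 \<Rightarrow> real^3" where
  "frame_coord p v = vector [v$1, v$2, contact_form p v]"

definition frame_vec :: "real^3 \<Rightarrow> real^3 \<Rightarrow> real^3" where
  "frame_vec p c = c$1 *\<^sub>R E1 p + c$2 *\<^sub>R E2 p + c$3 *\<^sub>R ET p"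

definition adapted_metric :: "real^3 \<Rightarrow> real^3 \<Rightarrow> real^3 \<Rightarrow> real" where
  "adapted_metric p v w = frame_coord p v \<bullet> frame_coord p w"

text \<open>\<open>J\<close> is only meant to be applied to vectors of the contact plane at \<open>p\<close>.\<close>

definition J :: "real^3 \<Rightarrow> real^3 \<Rightarrow> real^3" where
  "J p v = frame_coord p v $ 1 *\<^sub>R E2 p - frame_coord p v $ 2 *\<^sub>R E1 p"

lemmas heis_defs = E1_def E2_def ET_def contact_form_def frame_coord_def frame_vec_def
  adapted_metric_def J_def heis_mult_def

lemma frame_vec_frame_coord: "frame_vec p (frame_coord p v) = v"
  by (simp add: heis_defs vec_eq_iff forall_3)

lemma frame_coord_frame_vec: "frame_coord p (frame_vec p c) = c"
  by (simp add: heis_defs vec_eq_iff forall_3 algebra_simps)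

lemma frame_orthonormal:
  "adapted_metric p (E1 p) (E1 p) = 1" "adapted_metric p (E2 p) (E2 p) = 1"
  "adapted_metric p (ET p) (ET p) = 1" "adapted_metric p (E1 p) (E2 p) = 0"
  "adapted_metric p (E1 p) (ET p) = 0" "adapted_metric p (E2 p) (ET p) = 0"
  by (simp_all add: heis_defs inner_vec_def sum_3)

lemma J_frame: "J p (E1 p) = E2 p" "J p (E2 p) = - E1 p"
  by (simp_all add: heis_defs vec_eq_iff forall_3)

text \<open>Left invariance: left translations are affine, so their differential is given by differences.\<close>

lemma frame_left_invariant:
  "heis_mult p (q + t *\<^sub>R E1 q) = heis_mult p q + t *\<^sub>R E1 (heis_mult p q)"
  "heis_mult p (q + t *\<^sub>R E2 q) = heis_mult p q + t *\<^sub>R E2 (heis_mult p q)"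
  "heis_mult p (q + t *\<^sub>R ET q) = heis_mult p q + t *\<^sub>R ET (heis_mult p q)"
  by (simp_all add: heis_defs vec_eq_iff forall_3 algebra_simps)


section \<open>Surfaces in local coordinates\<close>

text \<open>A coordinate patch \<open>X\<close> on \<open>U\<close> of an embedded surface. Vector fields along the surface are
  functions on \<open>U\<close>, the value at \<open>u\<close> being a tangent vector at \<open>X u\<close>.\<close>

definition surface_patch :: "(real \<times> real) set \<Rightarrow> (real \<times> real \<Rightarrow> real^3) \<Rightarrow> bool" where
  "surface_patch U X \<longleftrightarrow> open U \<and> smooth_on U X \<and>
     (\<forall>u\<in>U. inj (frechet_derivative X (at u))) \<and>
     (\<exists>Y. homeomorphism U (X ` U) X Y)"

definition tangent_plane :: "(real \<times> real \<Rightarrow> real^3) \<Rightarrow> real \<times> real \<Rightarrow> (real^3) set" where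
  "tangent_plane X u = range (frechet_derivative X (at u))"

definition singular_point :: "(real \<times> real \<Rightarrow> real^3) \<Rightarrow> real \<times> real \<Rightarrow> bool" where
  "singular_point X u \<longleftrightarrow> tangent_plane X u = contact_plane (X u)"

text \<open>\<open>nabla X V u w\<close> is the covariant derivative at \<open>u\<close> of the vector field \<open>V\<close> along \<open>X\<close> in the
  direction of the tangent vector \<open>frechet_derivative X (at u) w\<close>, for the connection making
  \<open>E1, E2, ET\<close> parallel.\<close>

definition nabla ::
  "(real \<times> real \<Rightarrow> real^3) \<Rightarrow> (real \<times> real \<Rightarrow> real^3) \<Rightarrow> real \<times> real \<Rightarrow> real \<times> real \<Rightarrow> real^3" where
  "nabla X V u w =
     frame_vec (X u) (frechet_derivative (\<lambda>u'. frame_coord (X u') (V u')) (at u) w)"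

definition unit_contact_field ::
  "(real \<times> real) set \<Rightarrow> (real \<times> real \<Rightarrow> real^3) \<Rightarrow> (real \<times> real \<Rightarrow> real^3) \<Rightarrow> bool" where
  "unit_contact_field U X e1 \<longleftrightarrow> smooth_on U e1 \<and>
     (\<forall>u\<in>U. e1 u \<in> tangent_plane X u \<inter> contact_plane (X u) \<and>
             adapted_metric (X u) (e1 u) (e1 u) = 1)"

definition e2_field ::
  "(real \<times> real \<Rightarrow> real^3) \<Rightarrow> (real \<times> real \<Rightarrow> real^3) \<Rightarrow> real \<times> real \<Rightarrow> real^3" where
  "e2_field X e1 u = J (X u) (e1 u)"

text \<open>The unique \<open>w\<close> with \<open>frechet_derivative X (at u) w = e1 u\<close> represents \<open>e1 u\<close> in coordinates.\<close>

definition has_p_mean_curvature ::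
  "(real \<times> real) set \<Rightarrow> (real \<times> real \<Rightarrow> real^3) \<Rightarrow> (real \<times> real \<Rightarrow> real^3) \<Rightarrow>
   (real \<times> real \<Rightarrow> real) \<Rightarrow> bool" where
  "has_p_mean_curvature U X e1 H \<longleftrightarrow>
     (\<forall>u\<in>U. \<forall>w. frechet_derivative X (at u) w = e1 u \<longrightarrow>
        nabla X (e2_field X e1) u w = - H u *\<^sub>R e1 u)"

definition p_minimal ::
  "(real \<times> real) set \<Rightarrow> (real \<times> real \<Rightarrow> real^3) \<Rightarrow> (real \<times> real \<Rightarrow> real^3) \<Rightarrow> bool" where
  "p_minimal U X e1 \<longleftrightarrow> has_p_mean_curvature U X e1 (\<lambda>_. 0)"

definition has_alpha_function ::
  "(real \<times> real) set \<Rightarrow> (real \<times> real \<Rightarrow> real^3) \<Rightarrow> (real \<times> real \<Rightarrow> real^3) \<Rightarrow>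
   (real \<times> real \<Rightarrow> real) \<Rightarrow> bool" where
  "has_alpha_function U X e1 \<alpha> \<longleftrightarrow>
     (\<forall>u\<in>U. \<alpha> u *\<^sub>R e2_field X e1 u + ET (X u) \<in> tangent_plane X u)"

definition e2_hat ::
  "(real \<times> real \<Rightarrow> real^3) \<Rightarrow> (real \<times> real \<Rightarrow> real^3) \<Rightarrow> (real \<times> real \<Rightarrow> real) \<Rightarrow>
   real \<times> real \<Rightarrow> real^3" where
  "e2_hat X e1 \<alpha> u = (1 / sqrt (1 + (\<alpha> u)\<^sup>2)) *\<^sub>R (\<alpha> u *\<^sub>R e2_field X e1 u + ET (X u))"

definition compatible_coordinates ::
  "(real \<times> real) set \<Rightarrow> (real \<times> real \<Rightarrow> real^3) \<Rightarrow> (real \<times> real \<Rightarrow> real^3) \<Rightarrow> bool" where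
  "compatible_coordinates U X e1 \<longleftrightarrow> (\<forall>u\<in>U. e1 u = frechet_derivative X (at u) (1, 0))"

definition metric_represented_by ::
  "(real \<times> real) set \<Rightarrow> (real \<times> real \<Rightarrow> real^3) \<Rightarrow> (real \<times> real \<Rightarrow> real^3) \<Rightarrow>
   (real \<times> real \<Rightarrow> real) \<Rightarrow> (real \<times> real \<Rightarrow> real) \<Rightarrow> (real \<times> real \<Rightarrow> real) \<Rightarrow> bool" where
  "metric_represented_by U X e1 \<alpha> a b \<longleftrightarrow> smooth_on U a \<and> smooth_on U b \<and>
     (\<forall>u\<in>U. b u > 0 \<and>
        e2_hat X e1 \<alpha> u = a u *\<^sub>R frechet_derivative X (at u) (1, 0)
                        + b u *\<^sub>R frechet_derivative X (at u) (0, 1))"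

text \<open>The functions \<open>c1\<close> and \<open>c2\<close> live on the set \<open>snd ` U\<close> of occurring values of \<open>y\<close>. That the
  denominator vanishes nowhere is part of \<open>\<alpha>\<close> being given by the quotient on all of \<open>U\<close>; it does
  not follow from \<open>c2 y \<noteq> 0\<close>.\<close>

definition general_type ::
  "(real \<times> real) set \<Rightarrow> (real \<Rightarrow> real) \<Rightarrow> (real \<Rightarrow> real) \<Rightarrow> (real \<times> real \<Rightarrow> real) \<Rightarrow> bool" where
  "general_type U c1 c2 \<alpha> \<longleftrightarrow> smooth_on (snd ` U) c1 \<and> smooth_on (snd ` U) c2 \<and>
     (\<forall>y\<in>snd ` U. c2 y \<noteq> 0) \<and>
     (\<forall>(x, y)\<in>U. (x + c1 y)\<^sup>2 + c2 y \<noteq> 0 \<and>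
        \<alpha> (x, y) = (x + c1 y) / ((x + c1 y)\<^sup>2 + c2 y))"

text \<open>The quotient \<open>\<bar>\<alpha>\<bar> / \<bar>x + c1 y\<bar>\<close>, extended continuously to \<open>x + c1 y = 0\<close>.\<close>

definition alpha_quotient ::
  "(real \<Rightarrow> real) \<Rightarrow> (real \<Rightarrow> real) \<Rightarrow> (real \<times> real \<Rightarrow> real) \<Rightarrow> real \<Rightarrow> real \<Rightarrow> real" where
  "alpha_quotient c1 c2 \<alpha> x y =
     (if x + c1 y = 0 then 1 / \<bar>(x + c1 y)\<^sup>2 + c2 y\<bar> else \<bar>\<alpha> (x, y)\<bar> / \<bar>x + c1 y\<bar>)"

end

theory Submission
  imports Defs
begin

text \<open>In compatible coordinates \<open>p\<close>-minimality makes the surface ruled: \<open>\<partial>\<^sub>x X = e1\<close> does not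
  depend on \<open>x\<close>. Hence \<open>\<partial>\<^sub>y X\<close> is affine in \<open>x\<close>, and differentiating its coefficients in the frame
  \<open>e1, e2, ET\<close> with respect to \<open>x\<close> gives \<open>\<partial>\<^sub>x (a/b) = 0\<close> and \<open>\<partial>\<^sub>x C = 2 \<alpha> C\<close>, where
  \<open>C = 1/(b \<surd>(1 + \<alpha>\<^sup>2))\<close>. With \<open>D = (x + c1 y)\<^sup>2 + c2 y\<close> one has \<open>\<partial>\<^sub>x D = 2 \<alpha> D\<close> as well, so \<open>D/C\<close>
  depends only on \<open>y\<close>; take \<open>k = ln \<bar>D/C\<bar>\<close> and \<open>h = (a/b) exp k\<close>.\<close>

section \<open>Calculus of smooth maps\<close>

lemma frechet_derivative_on_eq:
  assumes "(f has_derivative f') (at x)"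
  shows "frechet_derivative f (at x) = f'"
  using assms by (metis frechet_derivative_at)

text \<open>As \<open>S\<close> is open, functions agreeing on \<open>S\<close> agree near each of
  its points, so their derivatives there coincide as well.\<close>

lemma Ck_on_cong:
  assumes "open S" "\<And>x. x \<in> S \<Longrightarrow> f x = g x" "Ck_on n S f"
  shows "Ck_on n S g"
  using assms(2,3)
proof (induction n arbitrary: f g)
  case 0
  then show ?case
    using continuous_on_cong[of S S f g] by simp
next
  case (Suc n)
  have D: "(g has_derivative frechet_derivative f (at x)) (at x)" if "x \<in> S" for x
  proof -
    have "(f has_derivative frechet_derivative f (at x)) (at x)"
      using Suc.prems(2) that by (simp add: frechet_derivative_works)
    then show ?thesis
      by (rule has_derivative_transform_within_open[OF _ assms(1) that]) (rule Suc.prems(1))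
  qed
  have "Ck_on n S (\<lambda>x. frechet_derivative g (at x) v)" for v
  proof (rule Suc.IH)
    show "Ck_on n S (\<lambda>x. frechet_derivative f (at x) v)"
      using Suc.prems(2) by simp
  qed (simp add: frechet_derivative_on_eq[OF D])
  moreover have "g differentiable (at x)" if "x \<in> S" for x
    using D[OF that] by (rule differentiableI)
  ultimately show ?case
    by simp
qed

text \<open>Allows an explicit derivative formula, valid on \<open>S\<close> only, in place of
  \<open>frechet_derivative\<close>; the induction steps below mostly end with it.\<close>

lemma Ck_on_SucI:
  assumes "open S" "\<And>x. x \<in> S \<Longrightarrow> (f has_derivative f' x) (at x)"
    and "\<And>v. Ck_on n S (\<lambda>x. f' x v)"
  shows "Ck_on (Suc n) S f"
proof -
  have "Ck_on n S (\<lambda>x. frechet_derivative f (at x) v)" for v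
    by (rule Ck_on_cong[OF assms(1) _ assms(3)[of v]])
      (simp add: frechet_derivative_on_eq[OF assms(2)])
  then show ?thesis
    using assms(2) by (auto simp: differentiable_def)
qed

text \<open>The recursion asks for continuity of the last derivatives only; that of the earlier ones
  comes from differentiability. Needed wherever a derivative formula, such as the product rule,
  contains the function itself.\<close>

lemma Ck_on_Suc_imp: "Ck_on (Suc n) S f \<Longrightarrow> Ck_on n S f"
proof (induction n arbitrary: f)
  case 0
  then show ?case
    by (auto intro!: continuous_at_imp_continuous_on differentiable_imp_continuous_within)
next
  case (Suc n)
  then have "\<forall>x\<in>S. f differentiable (at x)"
    and "\<And>v. Ck_on (Suc n) S (\<lambda>x. frechet_derivative f (at x) v)"
    by simp_all
  then show ?case
    using Suc.IH by simp
qed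

lemma Ck_on_has_derivative:
  "Ck_on (Suc n) S f \<Longrightarrow> x \<in> S \<Longrightarrow> (f has_derivative frechet_derivative f (at x)) (at x)"
  by (simp add: frechet_derivative_works)

lemma Ck_on_const:
  assumes "open S"
  shows "Ck_on n S (\<lambda>_. c)"
proof (induction n arbitrary: c)
  case (Suc n)
  show ?case
    by (rule Ck_on_SucI[OF assms, where f' = "\<lambda>_ _. 0"]) (auto intro: Suc)
qed simp

lemma Ck_on_add:
  assumes "open S" "Ck_on n S f" "Ck_on n S g"
  shows "Ck_on n S (\<lambda>x. f x + g x)"
  using assms(2,3)
proof (induction n arbitrary: f g)
  case (Suc n)
  show ?case
    by (rule Ck_on_SucI[OF assms(1) has_derivative_add
          [OF Ck_on_has_derivative[OF Suc.prems(1)] Ck_on_has_derivative[OF Suc.prems(2)]]])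
      (use Suc in auto)
qed (auto intro!: continuous_intros)

lemma Ck_on_mult:
  fixes f g :: "'a::real_normed_vector \<Rightarrow> real"
  assumes "open S" "Ck_on n S f" "Ck_on n S g"
  shows "Ck_on n S (\<lambda>x. f x * g x)"
  using assms(2,3)
proof (induction n arbitrary: f g)
  case (Suc n)
  note D = Ck_on_has_derivative[OF Suc.prems(1)] Ck_on_has_derivative[OF Suc.prems(2)]
  show ?case
    by (rule Ck_on_SucI[OF assms(1) has_derivative_mult[OF D]], assumption, assumption)
      (use Suc Ck_on_Suc_imp[OF Suc.prems(1)] Ck_on_Suc_imp[OF Suc.prems(2)]
        in \<open>auto intro!: Ck_on_add[OF assms(1)]\<close>)
qed (auto intro!: continuous_intros)

lemma Ck_on_bounded_linear:
  assumes "bounded_linear L" "open S" "Ck_on n S f"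
  shows "Ck_on n S (\<lambda>x. L (f x))"
  using assms(3)
proof (induction n arbitrary: f)
  case 0
  then show ?case
    using bounded_linear.continuous_on[OF assms(1)] by simp
next
  case (Suc n)
  show ?case
    by (rule Ck_on_SucI[OF assms(2) bounded_linear.has_derivative[OF assms(1)
          Ck_on_has_derivative[OF Suc.prems]]]) (use Suc in auto)
qed

text \<open>The inner map has the constant derivative \<open>L\<close>, so each directional
  derivative is a composite of the same form, with \<open>f\<close> replaced by its derivative in
  direction \<open>L v\<close>.\<close>

lemma Ck_on_compose_affine:
  assumes "bounded_linear L" "open T" "\<And>x. x \<in> T \<Longrightarrow> L x + c \<in> S" "Ck_on n S f"
  shows "Ck_on n T (\<lambda>x. f (L x + c))"
  using assms(4)
proof (induction n arbitrary: f)
  case 0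
  have "continuous_on T (\<lambda>x. L x + c)"
    by (intro continuous_intros linear_continuous_on assms(1))
  then show ?case
    using 0 assms(3) by (auto intro: continuous_on_compose2)
next
  case (Suc n)
  have D: "((\<lambda>x. f (L x + c)) has_derivative (\<lambda>v. frechet_derivative f (at (L x + c)) (L v))) (at x)"
    if "x \<in> T" for x
  proof -
    have "((\<lambda>x. L x + c) has_derivative L) (at x)"
      using has_derivative_add[OF bounded_linear_imp_has_derivative[OF assms(1)] has_derivative_const]
      by simp
    then show ?thesis
      using has_derivative_compose Ck_on_has_derivative[OF Suc.prems assms(3)[OF that]] by blast
  qed
  show ?case
    by (rule Ck_on_SucI[OF assms(2) D]) (use Suc in auto)
qed

text \<open>The derivative -f'/f^2 contains 1/f itself, whose regularity of one order less is the
  induction hypothesis.\<close>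

lemma Ck_on_inverse:
  fixes f :: "'a::real_normed_vector \<Rightarrow> real"
  assumes "open S" "Ck_on n S f" "\<And>x. x \<in> S \<Longrightarrow> f x \<noteq> 0"
  shows "Ck_on n S (\<lambda>x. inverse (f x))"
  using assms(2)
proof (induction n)
  case 0
  then show ?case
    using assms(3) by (auto intro!: continuous_intros)
next
  case (Suc n)
  have I: "Ck_on n S (\<lambda>x. inverse (f x))"
    using Suc.IH Ck_on_Suc_imp[OF Suc.prems] by blast
  have D: "((\<lambda>x. inverse (f x)) has_derivative
      (\<lambda>v. (-1) * ((inverse (f x) * frechet_derivative f (at x) v) * inverse (f x)))) (at x)"
    if "x \<in> S" for x
    using Deriv.has_derivative_inverse[OF assms(3)[OF that] Ck_on_has_derivative[OF Suc.prems that]]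
    by simp
  show ?case
    by (rule Ck_on_SucI[OF assms(1) D], assumption, intro Ck_on_mult assms(1) I Ck_on_const)
      (use Suc.prems in auto)
qed

text \<open>The sign is constant near \<open>x\<close>, so the absolute value can be replaced by
  \<open>y\<close> or by \<open>- y\<close>.\<close>

lemma DERIV_ln_abs:
  assumes "x \<noteq> (0::real)"
  shows "((\<lambda>x. ln \<bar>x\<bar>) has_real_derivative inverse x) (at x)"
proof (cases "x > 0")
  case True
  have "\<forall>\<^sub>F y in nhds x. ln \<bar>y\<bar> = ln y"
    using eventually_nhds_in_open[of "{0<..}" x] True by (auto elim!: eventually_mono)
  then show ?thesis
    using DERIV_ln[OF True] DERIV_cong_ev[OF refl _ refl] by metis
next
  case False
  then have "x < 0" using assms by simp
  have "\<forall>\<^sub>F y in nhds x. ln \<bar>y\<bar> = ln (- y)"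
    using eventually_nhds_in_open[of "{..<0}" x] \<open>x < 0\<close> by (auto elim!: eventually_mono)
  moreover have "((\<lambda>y. ln (- y)) has_real_derivative inverse x) (at x)"
    using \<open>x < 0\<close> by (auto intro!: derivative_eq_intros simp: field_simps)
  ultimately show ?thesis
    using DERIV_cong_ev[OF refl _ refl] by metis
qed

text \<open>The derivative f'/f no longer involves the logarithm, so a case distinction on
  \<open>n\<close> replaces induction.\<close>

lemma Ck_on_ln_abs:
  fixes f :: "'a::real_normed_vector \<Rightarrow> real"
  assumes "open S" "Ck_on n S f" "\<And>x. x \<in> S \<Longrightarrow> f x \<noteq> 0"
  shows "Ck_on n S (\<lambda>x. ln \<bar>f x\<bar>)"
proof (cases n)
  case 0
  then show ?thesis
    using assms by (auto intro!: continuous_intros)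
next
  case (Suc m)
  note f = assms(2)[unfolded Suc]
  have D: "((\<lambda>x. ln \<bar>f x\<bar>) has_derivative (\<lambda>v. inverse (f x) * frechet_derivative f (at x) v)) (at x)"
    if "x \<in> S" for x
    using has_derivative_compose[OF Ck_on_has_derivative[OF f that]
        DERIV_ln_abs[OF assms(3)[OF that], unfolded has_field_derivative_def]] .
  show ?thesis
    unfolding Suc
    by (rule Ck_on_SucI[OF assms(1) D], assumption,
        intro Ck_on_mult Ck_on_inverse assms(1) Ck_on_Suc_imp[OF f])
      (use f assms(3) in auto)
qed

lemma Ck_on_exp:
  fixes f :: "'a::real_normed_vector \<Rightarrow> real"
  assumes "open S" "Ck_on n S f"
  shows "Ck_on n S (\<lambda>x. exp (f x))"
  using assms(2)
proof (induction n)
  case 0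
  then show ?case by (auto intro!: continuous_intros)
next
  case (Suc n)
  have D: "((\<lambda>x. exp (f x)) has_derivative (\<lambda>v. exp (f x) * frechet_derivative f (at x) v)) (at x)"
    if "x \<in> S" for x
    using has_derivative_compose[OF Ck_on_has_derivative[OF Suc.prems that]
        DERIV_exp[of "f x", unfolded has_field_derivative_def]] .
  show ?case
    by (rule Ck_on_SucI[OF assms(1) D], assumption, intro Ck_on_mult assms(1) Suc.IH
        Ck_on_Suc_imp[OF Suc.prems]) (use Suc.prems in auto)
qed

lemma Ck_on_local:
  assumes "\<And>x. x \<in> S \<Longrightarrow> \<exists>T. open T \<and> x \<in> T \<and> Ck_on n T f"
  shows "Ck_on n S f"
  using assms
proof (induction n arbitrary: f)
  case 0
  show ?case
    by (auto intro!: continuous_at_imp_continuous_on)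
      (metis "0" Ck_on.simps(1) continuous_on_eq_continuous_at)
next
  case (Suc n)
  have "Ck_on n S (\<lambda>x. frechet_derivative f (at x) v)" for v
    by (rule Suc.IH) (use Suc.prems in force)
  then show ?case
    using Suc.prems by force
qed

section \<open>Transfer of the C^n rules to smooth maps\<close>

lemma smooth_on_has_derivative:
  "smooth_on S f \<Longrightarrow> x \<in> S \<Longrightarrow> (f has_derivative frechet_derivative f (at x)) (at x)"
  unfolding smooth_on_def by (rule Ck_on_has_derivative) (rule spec)

lemma smooth_on_cong:
  assumes "open S" "\<And>x. x \<in> S \<Longrightarrow> f x = g x" "smooth_on S f"
  shows "smooth_on S g"
  using assms(3) Ck_on_cong[OF assms(1,2)] by (simp add: smooth_on_def)

lemma smooth_on_const: "open S \<Longrightarrow> smooth_on S (\<lambda>_. c)"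
  by (simp add: smooth_on_def Ck_on_const)

lemma smooth_on_add:
  "open S \<Longrightarrow> smooth_on S f \<Longrightarrow> smooth_on S g \<Longrightarrow> smooth_on S (\<lambda>x. f x + g x)"
  by (simp add: smooth_on_def Ck_on_add)

lemma smooth_on_mult:
  fixes f g :: "'a::real_normed_vector \<Rightarrow> real"
  shows "open S \<Longrightarrow> smooth_on S f \<Longrightarrow> smooth_on S g \<Longrightarrow> smooth_on S (\<lambda>x. f x * g x)"
  by (simp add: smooth_on_def Ck_on_mult)

lemma smooth_on_bounded_linear:
  "bounded_linear L \<Longrightarrow> open S \<Longrightarrow> smooth_on S f \<Longrightarrow> smooth_on S (\<lambda>x. L (f x))"
  by (simp add: smooth_on_def Ck_on_bounded_linear)

lemma smooth_on_compose_affine: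
  "bounded_linear L \<Longrightarrow> open T \<Longrightarrow> (\<And>x. x \<in> T \<Longrightarrow> L x + c \<in> S) \<Longrightarrow> smooth_on S f
    \<Longrightarrow> smooth_on T (\<lambda>x. f (L x + c))"
  unfolding smooth_on_def using Ck_on_compose_affine by blast

lemma smooth_on_id:
  assumes "open S"
  shows "smooth_on S (\<lambda>x. x)"
  unfolding smooth_on_def
proof
  fix n show "Ck_on n S (\<lambda>x. x)"
  proof (cases n)
    case (Suc m)
    then show ?thesis
      using Ck_on_SucI[OF assms has_derivative_ident Ck_on_const[OF assms]] by blast
  qed simp
qed

lemma smooth_on_inverse:
  fixes f :: "'a::real_normed_vector \<Rightarrow> real"
  shows "open S \<Longrightarrow> smooth_on S f \<Longrightarrow> (\<And>x. x \<in> S \<Longrightarrow> f x \<noteq> 0) \<Longrightarrow> smooth_on S (\<lambda>x. inverse (f x))"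
  unfolding smooth_on_def by (intro allI Ck_on_inverse) auto

lemma smooth_on_ln_abs:
  fixes f :: "'a::real_normed_vector \<Rightarrow> real"
  shows "open S \<Longrightarrow> smooth_on S f \<Longrightarrow> (\<And>x. x \<in> S \<Longrightarrow> f x \<noteq> 0) \<Longrightarrow> smooth_on S (\<lambda>x. ln \<bar>f x\<bar>)"
  unfolding smooth_on_def by (intro allI Ck_on_ln_abs) auto

lemma smooth_on_exp:
  fixes f :: "'a::real_normed_vector \<Rightarrow> real"
  shows "open S \<Longrightarrow> smooth_on S f \<Longrightarrow> smooth_on S (\<lambda>x. exp (f x))"
  by (simp add: smooth_on_def Ck_on_exp)

lemma smooth_on_frechet_derivative:
  "smooth_on S f \<Longrightarrow> smooth_on S (\<lambda>x. frechet_derivative f (at x) v)"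
  unfolding smooth_on_def
proof
  fix n assume "\<forall>n. Ck_on n S f"
  then have "Ck_on (Suc n) S f" ..
  then show "Ck_on n S (\<lambda>x. frechet_derivative f (at x) v)" by simp
qed

lemma smooth_on_local:
  assumes "\<And>x. x \<in> S \<Longrightarrow> \<exists>T. open T \<and> x \<in> T \<and> smooth_on T f"
  shows "smooth_on S f"
  unfolding smooth_on_def
proof
  fix n show "Ck_on n S f"
    by (rule Ck_on_local) (use assms in \<open>force simp: smooth_on_def\<close>)
qed

section \<open>Functions on plane domains with connected slices\<close>

lemma has_vector_derivative_slice_fst:
  fixes f :: "real \<times> real \<Rightarrow> 'b::real_normed_vector"
  assumes "(f has_derivative f') (at (x, y))"
  shows "((\<lambda>x. f (x, y)) has_vector_derivative f' (1, 0)) (at x)"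
proof -
  have "((\<lambda>x. (x, y)) has_derivative (\<lambda>t. (t, 0))) (at x)"
    by (intro derivative_intros)
  from has_derivative_compose[OF this assms]
  have "((\<lambda>x. f (x, y)) has_derivative (\<lambda>t. f' (t, 0))) (at x)" .
  moreover have "(\<lambda>t. f' (t, 0)) = (\<lambda>t. t *\<^sub>R f' (1, 0))"
  proof
    fix t :: real
    have "(t, 0) = t *\<^sub>R (1::real, 0::real)"
      by simp
    then show "f' (t, 0) = t *\<^sub>R f' (1, 0)"
      by (metis linear_scale[OF has_derivative_linear[OF assms]])
  qed
  ultimately show ?thesis
    by (simp only: has_vector_derivative_def)
qed

lemma has_vector_derivative_slice_snd:
  fixes f :: "real \<times> real \<Rightarrow> 'b::real_normed_vector"
  assumes "(f has_derivative f') (at (x, y))"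
  shows "((\<lambda>y. f (x, y)) has_vector_derivative f' (0, 1)) (at y)"
proof -
  have "((\<lambda>y. (x, y)) has_derivative (\<lambda>t. (0, t))) (at y)"
    by (intro derivative_intros)
  from has_derivative_compose[OF this assms]
  have "((\<lambda>y. f (x, y)) has_derivative (\<lambda>t. f' (0, t))) (at y)" .
  moreover have "(\<lambda>t. f' (0, t)) = (\<lambda>t. t *\<^sub>R f' (0, 1))"
  proof
    fix t :: real
    have "(0, t) = t *\<^sub>R (0::real, 1::real)"
      by simp
    then show "f' (0, t) = t *\<^sub>R f' (0, 1)"
      by (metis linear_scale[OF has_derivative_linear[OF assms]])
  qed
  ultimately show ?thesis
    by (simp only: has_vector_derivative_def)
qed

text \<open>Connected subsets of the line are convex, and on a convex set a vanishing derivative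
  forces constancy.\<close>

lemma constant_on_connected:
  fixes f :: "real \<Rightarrow> 'b::real_normed_vector"
  assumes "connected S" "\<And>x. x \<in> S \<Longrightarrow> (f has_vector_derivative 0) (at x)" "x \<in> S" "x' \<in> S"
  shows "f x = f x'"
proof -
  have "convex S"
    using assms(1) by (simp add: connected_convex_1)
  then obtain c where "\<And>x. x \<in> S \<Longrightarrow> f x = c"
    using has_derivative_zero_constant[of S f] assms(2)
    by (auto simp: has_vector_derivative_def intro: has_derivative_at_withinI)
  then show ?thesis
    using assms(3,4) by simp
qed

lemma open_slice_snd: "open U \<Longrightarrow> open {y. (x, y) \<in> U}"
  for U :: "('a::topological_space \<times> 'b::topological_space) set"
  using open_vimage[of U "\<lambda>y. (x, y)"] by (simp add: vimage_def continuous_intros)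

text \<open>Near a given value of \<open>y\<close> one fixed \<open>x\<close> serves: the set of
  \<open>y\<close> with \<open>(x, y) \<in> U\<close> is open, and there the descended function is
  the slice of \<open>F\<close> at \<open>x\<close>. The choice of \<open>x\<close> made by
  \<open>SOME\<close> may jump with \<open>y\<close>, but by \<open>const\<close> it does not affect
  the value.\<close>

lemma smooth_on_descend:
  fixes F :: "real \<times> real \<Rightarrow> 'b::real_normed_vector"
  assumes "open U" "smooth_on U F"
    and const: "\<And>x x' y. (x, y) \<in> U \<Longrightarrow> (x', y) \<in> U \<Longrightarrow> F (x, y) = F (x', y)"
  obtains f where "smooth_on (snd ` U) f" "\<And>x y. (x, y) \<in> U \<Longrightarrow> F (x, y) = f y"
proof
  let ?f = "\<lambda>y. F (SOME x. (x, y) \<in> U, y)"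
  show eq: "F (x, y) = ?f y" if "(x, y) \<in> U" for x y
    using const[OF that] someI[of "\<lambda>x. (x, y) \<in> U", OF that] by simp
  show "smooth_on (snd ` U) ?f"
  proof (rule smooth_on_local)
    fix y assume "y \<in> snd ` U"
    then obtain x where xy: "(x, y) \<in> U" by auto
    let ?T = "{y. (x, y) \<in> U}"
    have T: "open ?T"
      by (rule open_slice_snd[OF assms(1)])
    have "bounded_linear (\<lambda>t::real. (0::real, t))"
      by (intro bounded_linear_Pair bounded_linear_zero bounded_linear_ident)
    from smooth_on_compose_affine[OF this T _ assms(2), of "(x, 0)"]
    have "smooth_on ?T (\<lambda>y. F (x, y))"
      by simp
    then have "smooth_on ?T ?f"
      by (rule smooth_on_cong[OF T, rotated]) (simp add: eq)
    then show "\<exists>T. open T \<and> y \<in> T \<and> smooth_on T ?f"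
      using T xy by blast
  qed
qed

section \<open>\<open>p\<close>-minimal surfaces in compatible coordinates\<close>

lemma smooth_on_vec_nth:
  fixes f :: "'a::real_normed_vector \<Rightarrow> real^'n"
  shows "open S \<Longrightarrow> smooth_on S f \<Longrightarrow> smooth_on S (\<lambda>x. f x $ i)"
  by (rule smooth_on_bounded_linear[OF bounded_linear_vec_nth])

lemma has_derivative_vec_nth:
  "(f has_derivative f') F \<Longrightarrow> ((\<lambda>x. f x $ i) has_derivative (\<lambda>v. f' v $ i)) F"
  by (rule bounded_linear.has_derivative[OF bounded_linear_vec_nth])

lemma has_vector_derivative_vec_nth:
  "(f has_vector_derivative d) F \<Longrightarrow> ((\<lambda>x. f x $ i) has_real_derivative d $ i) F"
  using bounded_linear.has_vector_derivative[OF bounded_linear_vec_nth]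
  by (simp add: has_real_derivative_iff_has_vector_derivative)

text \<open>In frame coefficients \<open>J\<close> is a quarter turn that does not depend on the
  base point.\<close>

lemma frame_coord_J:
  assumes "v \<in> contact_plane p"
  shows "frame_coord p (J p v) = vector [- v$2, v$1, 0]"
  using assms by (simp add: heis_defs vec_eq_iff forall_3 algebra_simps)

lemma frame_vec_eq_0_iff: "frame_vec p c = 0 \<longleftrightarrow> c = 0"
proof
  assume "frame_vec p c = 0"
  then have "frame_coord p 0 = c"
    using frame_coord_frame_vec[of p c] by simp
  then show "c = 0"
    by (simp add: heis_defs vec_eq_iff forall_3)
qed (simp add: heis_defs)

section \<open>First-order identities for the unit contact field\<close>

locale compatible_p_minimal_patch =
  fixes U :: "(real \<times> real) set" and X e1 :: "real \<times> real \<Rightarrow> real^3"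
  assumes patch: "surface_patch U X"
    and unit_contact: "unit_contact_field U X e1"
    and minimal: "p_minimal U X e1"
    and compatible: "compatible_coordinates U X e1"
begin

abbreviation "DX u \<equiv> frechet_derivative X (at u)"
abbreviation "De u \<equiv> frechet_derivative e1 (at u)"

lemma open_U: "open U" and smooth_X: "smooth_on U X" and smooth_e1: "smooth_on U e1"
  using patch unit_contact by (auto simp: surface_patch_def unit_contact_field_def)

lemmas X_has_derivative = smooth_on_has_derivative[OF smooth_X]
  and e1_has_derivative = smooth_on_has_derivative[OF smooth_e1]

lemma DX_fst: "u \<in> U \<Longrightarrow> DX u (1, 0) = e1 u"
  using compatible by (simp add: compatible_coordinates_def)

lemma e1_in_contact_plane: "u \<in> U \<Longrightarrow> e1 u \<in> contact_plane (X u)"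
  using unit_contact by (auto simp: unit_contact_field_def)

lemma e1_contact: "u \<in> U \<Longrightarrow> e1 u $ 3 = X u $ 2 * e1 u $ 1 - X u $ 1 * e1 u $ 2"
  using e1_in_contact_plane[of u] by (simp add: contact_plane_def contact_form_def)

lemma e1_unit: "u \<in> U \<Longrightarrow> e1 u $ 1 * e1 u $ 1 + e1 u $ 2 * e1 u $ 2 = 1"
  using unit_contact e1_in_contact_plane[of u]
  by (auto simp: unit_contact_field_def adapted_metric_def frame_coord_def inner_vec_def sum_3
      contact_plane_def)

text \<open>Derivative of the identity \<open>e1_unit\<close>, whose right-hand side is
  constant.\<close>

lemma De_unit:
  assumes "u \<in> U"
  shows "e1 u $ 1 * De u v $ 1 + e1 u $ 2 * De u v $ 2 = 0"
proof -
  note D = has_derivative_vec_nth[OF e1_has_derivative[OF assms]]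
  have "((\<lambda>u. e1 u $ 1 * e1 u $ 1 + e1 u $ 2 * e1 u $ 2) has_derivative
      (\<lambda>v. (e1 u $ 1 * De u v $ 1 + De u v $ 1 * e1 u $ 1)
         + (e1 u $ 2 * De u v $ 2 + De u v $ 2 * e1 u $ 2))) (at u)"
    by (intro has_derivative_add has_derivative_mult D)
  moreover have "((\<lambda>u. e1 u $ 1 * e1 u $ 1 + e1 u $ 2 * e1 u $ 2) has_derivative (\<lambda>_. 0)) (at u)"
    by (rule has_derivative_transform_within_open[OF has_derivative_const open_U assms])
      (rule e1_unit[symmetric])
  ultimately have "(\<lambda>v. (e1 u $ 1 * De u v $ 1 + De u v $ 1 * e1 u $ 1)
      + (e1 u $ 2 * De u v $ 2 + De u v $ 2 * e1 u $ 2)) = (\<lambda>_. 0)"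
    by (rule has_derivative_unique)
  from fun_cong[OF this, of v] show ?thesis
    by (simp add: algebra_simps)
qed

text \<open>Product rule applied to \<open>e1_contact\<close>; the terms with \<open>DX\<close>
  arise because the contact form varies with the point.\<close>

lemma De_contact:
  assumes "u \<in> U"
  shows "De u v $ 3 = X u $ 2 * De u v $ 1 + DX u v $ 2 * e1 u $ 1
    - (X u $ 1 * De u v $ 2 + DX u v $ 1 * e1 u $ 2)"
proof -
  note D = has_derivative_vec_nth[OF e1_has_derivative[OF assms]]
    has_derivative_vec_nth[OF X_has_derivative[OF assms]]
  have "((\<lambda>u. X u $ 2 * e1 u $ 1 - X u $ 1 * e1 u $ 2) has_derivative
      (\<lambda>v. (X u $ 2 * De u v $ 1 + DX u v $ 2 * e1 u $ 1)
         - (X u $ 1 * De u v $ 2 + DX u v $ 1 * e1 u $ 2))) (at u)"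
    by (intro has_derivative_diff has_derivative_mult D)
  from has_derivative_transform_within_open[OF this open_U assms, of "\<lambda>u. e1 u $ 3"]
  have "((\<lambda>u. e1 u $ 3) has_derivative
      (\<lambda>v. (X u $ 2 * De u v $ 1 + DX u v $ 2 * e1 u $ 1)
         - (X u $ 1 * De u v $ 2 + DX u v $ 1 * e1 u $ 2))) (at u)"
    by (simp add: e1_contact)
  from has_derivative_unique[OF D(1) this] show ?thesis
    by (rule fun_cong)
qed

text \<open>The characteristic curves are straight lines.\<close>

lemma De_fst_eq_0:
  assumes "u \<in> U"
  shows "De u (1, 0) = 0"
proof -
  \<comment> \<open>\<open>L\<close> turns \<open>e1\<close> into the frame coefficients of its
    image under \<open>J\<close>. Being linear and independent of the point, it commutes with
    differentiation.\<close>
  define L :: "real^3 \<Rightarrow> real^3" where "L w = vector [- w$2, w$1, 0]" for w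
  have "bounded_linear L"
    unfolding linear_conv_bounded_linear[symmetric]
    by (rule linearI) (simp_all add: L_def vec_eq_iff forall_3)
  from bounded_linear.has_derivative[OF this e1_has_derivative[OF assms]]
  have "((\<lambda>u. L (e1 u)) has_derivative (\<lambda>v. L (De u v))) (at u)" .
  from has_derivative_transform_within_open[OF this open_U assms]
  have "((\<lambda>u. frame_coord (X u) (e2_field X e1 u)) has_derivative (\<lambda>v. L (De u v))) (at u)"
    by (simp add: e2_field_def frame_coord_J e1_in_contact_plane L_def)
  then have "nabla X (e2_field X e1) u (1, 0) = frame_vec (X u) (L (De u (1, 0)))"
    by (simp add: nabla_def frechet_derivative_on_eq)
  \<comment> \<open>In compatible coordinates the direction \<open>(1, 0)\<close> represents
    \<open>e1\<close>, so vanishing p-mean curvature kills this covariant derivative.\<close>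
  moreover have "nabla X (e2_field X e1) u (1, 0) = 0"
    using minimal assms DX_fst[OF assms]
    by (auto simp: p_minimal_def has_p_mean_curvature_def)
  ultimately have "L (De u (1, 0)) = 0"
    using frame_vec_eq_0_iff by metis
  then have "De u (1, 0) $ 1 = 0" "De u (1, 0) $ 2 = 0"
    by (simp_all add: L_def vec_eq_iff forall_3)
  \<comment> \<open>In direction \<open>(1, 0)\<close> one has \<open>DX u (1, 0) = e1 u\<close>, so
    the two \<open>DX\<close> terms of \<open>De_contact\<close> cancel and the third component
    vanishes with the other two.\<close>
  then show ?thesis
    using De_contact[OF assms, of "(1, 0)"] by (simp add: DX_fst[OF assms] vec_eq_iff forall_3)
qed

lemma X_slice: "(x, y) \<in> U \<Longrightarrow> ((\<lambda>x. X (x, y)) has_vector_derivative e1 (x, y)) (at x)"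
  using has_vector_derivative_slice_fst[OF X_has_derivative] by (simp add: DX_fst)

lemma e1_slice: "(x, y) \<in> U \<Longrightarrow> ((\<lambda>x. e1 (x, y)) has_vector_derivative 0) (at x)"
  using has_vector_derivative_slice_fst[OF e1_has_derivative] by (simp add: De_fst_eq_0)

text \<open>Since \<open>X\<close> is affine in the first coordinate, the symmetry of its mixed second derivatives
  is immediate.\<close>

lemma DX_snd_slice:
  assumes "(x, y) \<in> U"
  shows "((\<lambda>x. DX (x, y) (0, 1)) has_vector_derivative De (x, y) (0, 1)) (at x)"
proof -
  obtain A B where "open A" "open B" "(x, y) \<in> A \<times> B" "A \<times> B \<subseteq> U"
    by (rule open_prod_elim[OF open_U assms])
  then have AB: "open A" "open B" "x \<in> A" "y \<in> B" "A \<times> B \<subseteq> U"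
    by simp_all
  obtain r where r: "r > 0" "ball x r \<subseteq> A"
    by (rule openE[OF AB(1,3)])
  have U: "(x', y') \<in> U" if "x' \<in> ball x r" "y' \<in> B" for x' y'
    using AB r that by auto
  have x: "x \<in> ball x r"
    using r by simp
  \<comment> \<open>Integrates the constancy of \<open>e1\<close> along each segment. It holds for
    all \<open>y'\<close> in the neighbourhood \<open>B\<close>, so it can be differentiated in
    \<open>y'\<close>.\<close>
  have ruled: "X (x', y') = X (x, y') + (x' - x) *\<^sub>R e1 (x, y')"
    if "x' \<in> ball x r" "y' \<in> B" for x' y'
  proof -
    have e1: "e1 (t, y') = e1 (x, y')" if "t \<in> ball x r" for t
      by (rule constant_on_connected[OF connected_ball e1_slice[OF U]]) (use that x \<open>y' \<in> B\<close> in auto)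
    have "((\<lambda>t. X (t, y') - (t - x) *\<^sub>R e1 (x, y')) has_vector_derivative 0) (at t)"
      if "t \<in> ball x r" for t
      using e1[OF that]
      by (auto intro!: derivative_eq_intros X_slice U that \<open>y' \<in> B\<close>)
    from constant_on_connected[OF connected_ball this \<open>x' \<in> ball x r\<close> x] show ?thesis
      by (simp add: algebra_simps)
  qed
  \<comment> \<open>Both sides are the derivative at \<open>y\<close> of the slice of
    \<open>X\<close> at \<open>x'\<close>: once through \<open>ruled\<close>, once directly. The
    left side is visibly affine in \<open>x'\<close>.\<close>
  have "DX (x, y) (0, 1) + (x' - x) *\<^sub>R De (x, y) (0, 1) = DX (x', y) (0, 1)"
    if "x' \<in> ball x r" for x'
  proof (rule vector_derivative_unique_at)
    have "((\<lambda>y'. X (x, y') + (x' - x) *\<^sub>R e1 (x, y')) has_vector_derivative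
        DX (x, y) (0, 1) + (x' - x) *\<^sub>R De (x, y) (0, 1)) (at y)"
      by (intro has_vector_derivative_add bounded_linear.has_vector_derivative[OF bounded_linear_scaleR_right]
          has_vector_derivative_slice_snd X_has_derivative e1_has_derivative assms)
    then show "((\<lambda>y'. X (x', y')) has_vector_derivative
        DX (x, y) (0, 1) + (x' - x) *\<^sub>R De (x, y) (0, 1)) (at y)"
      by (rule has_vector_derivative_transform_within_open[OF _ AB(2,4)]) (rule ruled[OF that, symmetric])
    show "((\<lambda>y'. X (x', y')) has_vector_derivative DX (x', y) (0, 1)) (at y)"
      by (intro has_vector_derivative_slice_snd X_has_derivative U that AB)
  qed
  moreover have "((\<lambda>x'. DX (x, y) (0, 1) + (x' - x) *\<^sub>R De (x, y) (0, 1))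
      has_vector_derivative De (x, y) (0, 1)) (at x)"
    by (auto intro!: derivative_eq_intros)
  ultimately show ?thesis
    by (rule has_vector_derivative_transform_within_open[OF _ open_ball x, rotated])
qed

text \<open>Coefficients of \<open>\<partial>\<^sub>y\<close> in the frame \<open>e1, e2, ET\<close>; in terms of the metric they are
  \<open>- a/b\<close>, \<open>\<alpha>/(b \<surd>(1 + \<alpha>\<^sup>2))\<close> and \<open>1/(b \<surd>(1 + \<alpha>\<^sup>2))\<close>.\<close>

definition "coeff1 u = e1 u $ 1 * DX u (0, 1) $ 1 + e1 u $ 2 * DX u (0, 1) $ 2"
definition "coeff2 u = e1 u $ 1 * DX u (0, 1) $ 2 - e1 u $ 2 * DX u (0, 1) $ 1"
definition "coeff3 u = contact_form (X u) (DX u (0, 1))"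

lemma smooth_coeff1: "smooth_on U coeff1"
  unfolding coeff1_def
  by (intro smooth_on_add smooth_on_mult smooth_on_vec_nth smooth_on_frechet_derivative
      open_U smooth_X smooth_e1)

lemma smooth_coeff3: "smooth_on U coeff3"
proof -
  have "smooth_on U (\<lambda>u. DX u (0, 1) $ 3 + X u $ 1 * DX u (0, 1) $ 2
      + (-1) * (X u $ 2 * DX u (0, 1) $ 1))"
    by (intro smooth_on_add smooth_on_mult smooth_on_vec_nth smooth_on_frechet_derivative
        smooth_on_const open_U smooth_X)
  then show ?thesis
    unfolding coeff3_def contact_form_def by simp
qed

text \<open>As \<open>e1\<close> is constant in x, only the factor \<open>DX\<close> is
  differentiated. What remains is the horizontal inner product of \<open>e1\<close> with its
  y-derivative, which vanishes by unit length.\<close>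

lemma coeff1_slice:
  assumes "(x, y) \<in> U"
  shows "((\<lambda>x. coeff1 (x, y)) has_real_derivative 0) (at x)"
  unfolding coeff1_def
  using De_unit[OF assms, of "(0, 1)"]
  by (auto intro!: derivative_eq_intros has_vector_derivative_vec_nth e1_slice DX_snd_slice assms
      simp: algebra_simps)

text \<open>This is \<Theta>(\<partial>y) differentiated along \<partial>x, where
  \<Theta>(\<partial>x) = 0; so it equals d\<Theta>(\<partial>x, \<partial>y), and the factor 2
  comes from d\<Theta> = 2 dx \<and> dy. In coordinates \<open>De_contact\<close> supplies one half
  and the varying coefficients of \<Theta> the other.\<close>

lemma coeff3_slice:
  assumes "(x, y) \<in> U"
  shows "((\<lambda>x. coeff3 (x, y)) has_real_derivative 2 * coeff2 (x, y)) (at x)"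
  unfolding coeff2_def coeff3_def contact_form_def
  using De_contact[OF assms, of "(0, 1)"]
  by (auto intro!: derivative_eq_intros has_vector_derivative_vec_nth X_slice DX_snd_slice assms
      simp: algebra_simps)

text \<open>The expansion of \<open>e2_hat\<close> in coordinate fields is paired with
  \<open>e1\<close>, with \<open>e2\<close> and with the contact form, then solved for the
  coefficients of the second coordinate field.\<close>

lemma coeff_metric:
  assumes "metric_represented_by U X e1 \<alpha> a b" "u \<in> U"
  shows "coeff1 u = - a u / b u"
    and "coeff2 u = \<alpha> u * coeff3 u"
    and "coeff3 u = 1 / (b u * sqrt (1 + (\<alpha> u)\<^sup>2))"
proof -
  let ?s = "sqrt (1 + (\<alpha> u)\<^sup>2)" and ?V = "DX u (0, 1)"
  have s: "?s > 0" and b: "b u > 0"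
    using assms by (auto simp: metric_represented_by_def add_pos_nonneg)
  have "e2_hat X e1 \<alpha> u = a u *\<^sub>R e1 u + b u *\<^sub>R ?V"
    using assms by (simp add: metric_represented_by_def DX_fst)
  \<comment> \<open>First two components of the expansion: those of \<open>e2\<close> are
    \<open>- e1 u $ 2\<close> and \<open>e1 u $ 1\<close>, while \<open>ET\<close> contributes
    nothing to them.\<close>
  then have c: "- \<alpha> u * e1 u $ 2 / ?s = a u * e1 u $ 1 + b u * ?V $ 1"
    "\<alpha> u * e1 u $ 1 / ?s = a u * e1 u $ 2 + b u * ?V $ 2"
    and c3: "contact_form (X u) (e2_hat X e1 \<alpha> u) = contact_form (X u) (a u *\<^sub>R e1 u + b u *\<^sub>R ?V)"
    by (simp_all add: e2_hat_def e2_field_def heis_defs vec_eq_iff forall_3)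
  note unit = e1_unit[OF assms(2)]
  have "b u * coeff1 u + a u * (e1 u $ 1 * e1 u $ 1 + e1 u $ 2 * e1 u $ 2)
      = e1 u $ 1 * (a u * e1 u $ 1 + b u * ?V $ 1) + e1 u $ 2 * (a u * e1 u $ 2 + b u * ?V $ 2)"
    by (simp add: coeff1_def algebra_simps)
  also have "\<dots> = 0"
    unfolding c[symmetric] by simp
  finally show "coeff1 u = - a u / b u"
    using b unit by (simp add: field_simps)
  have "b u * coeff2 u
      = e1 u $ 1 * (a u * e1 u $ 2 + b u * ?V $ 2) - e1 u $ 2 * (a u * e1 u $ 1 + b u * ?V $ 1)"
    by (simp add: coeff2_def algebra_simps)
  also have "\<dots> = (\<alpha> u / ?s) * (e1 u $ 1 * e1 u $ 1 + e1 u $ 2 * e1 u $ 2)"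
    unfolding c[symmetric] by (simp add: algebra_simps)
  finally have 2: "coeff2 u = \<alpha> u / (b u * ?s)"
    using b s unit by (simp add: field_simps)
  have "contact_form (X u) (e2_hat X e1 \<alpha> u) = 1 / ?s"
    by (simp add: e2_hat_def e2_field_def heis_defs algebra_simps)
  moreover have "contact_form (X u) (a u *\<^sub>R e1 u + b u *\<^sub>R ?V) = b u * coeff3 u"
    by (simp add: coeff3_def contact_form_def e1_contact[OF assms(2)] algebra_simps)
  ultimately show 3: "coeff3 u = 1 / (b u * ?s)"
    using c3 b s by (simp add: field_simps)
  show "coeff2 u = \<alpha> u * coeff3 u"
    by (simp add: 2 3)
qed

end

section \<open>Integration along the characteristic lines\<close>

theorem proposition5p3:
  fixes U :: "(real \<times> real) set"
    and X e1 :: "real \<times> real \<Rightarrow> real^3"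
    and \<alpha> a b :: "real \<times> real \<Rightarrow> real"
    and c1 c2 :: "real \<Rightarrow> real"
  assumes "surface_patch U X"
    and "\<forall>y. connected {x. (x, y) \<in> U}"
    and "\<forall>u\<in>U. \<not> singular_point X u"
    and "unit_contact_field U X e1"
    and "p_minimal U X e1"
    and "has_alpha_function U X e1 \<alpha>"
    and "compatible_coordinates U X e1"
    and "metric_represented_by U X e1 \<alpha> a b"
    and "general_type U c1 c2 \<alpha>"
  shows "\<exists>h k :: real \<Rightarrow> real. smooth_on (snd ` U) h \<and> smooth_on (snd ` U) k \<and>
    (\<forall>(x, y)\<in>U.
       a (x, y) = alpha_quotient c1 c2 \<alpha> x y * h y / sqrt (1 + (\<alpha> (x, y))\<^sup>2) \<and>
       b (x, y) = alpha_quotient c1 c2 \<alpha> x y * exp (k y) / sqrt (1 + (\<alpha> (x, y))\<^sup>2))"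
proof -
  interpret compatible_p_minimal_patch U X e1
    using assms by unfold_locales
  note metric = coeff_metric[OF assms(8)]
  define D where "D u = (fst u + c1 (snd u)) * (fst u + c1 (snd u)) + c2 (snd u)" for u
  define G where "G u = D u * inverse (coeff3 u)" for u
  have D_nz: "D u \<noteq> 0" and \<alpha>: "\<alpha> u = (fst u + c1 (snd u)) / D u" if "u \<in> U" for u
    using assms(9) that by (cases u; force simp: general_type_def D_def power2_eq_square)+
  have b: "b u > 0" if "u \<in> U" for u
    using assms(8) that by (simp add: metric_represented_by_def)
  have s: "sqrt (1 + (\<alpha> u)\<^sup>2) > 0" for u
    by (simp add: add_pos_nonneg)
  have coeff3: "coeff3 u > 0" if "u \<in> U" for u
    using metric(3)[OF that] b[OF that] s[of u] by simp
  have G_nz: "G u \<noteq> 0" if "u \<in> U" for u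
    using D_nz[OF that] coeff3[OF that] by (simp add: G_def)
  have c: "smooth_on U (\<lambda>u. f (snd u))" if "smooth_on (snd ` U) f" for f :: "real \<Rightarrow> real"
    using smooth_on_compose_affine[OF bounded_linear_snd open_U, of 0 "snd ` U" f] that by simp
  have "smooth_on U D"
    unfolding D_def using assms(9)
    by (intro smooth_on_add smooth_on_mult smooth_on_bounded_linear[OF bounded_linear_fst]
        smooth_on_id c open_U) (auto simp: general_type_def)
  then have smooth_G: "smooth_on U G"
    unfolding G_def
    by (intro smooth_on_mult smooth_on_inverse smooth_coeff3 open_U) (use coeff3 in force)+
  have "((\<lambda>x. G (x, y)) has_real_derivative 0) (at x)" if "(x, y) \<in> U" for x y
  proof -
    have "((\<lambda>x. D (x, y)) has_real_derivative 2 * (x + c1 y)) (at x)"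
      unfolding D_def by (auto intro!: derivative_eq_intros)
    moreover have "((\<lambda>x. inverse (coeff3 (x, y))) has_real_derivative
        - (inverse (coeff3 (x, y)) * (2 * coeff2 (x, y)) * inverse (coeff3 (x, y)))) (at x)"
      using coeff3[OF that] by (intro DERIV_inverse' coeff3_slice that) simp
    ultimately have "((\<lambda>x. G (x, y)) has_real_derivative
        2 * (x + c1 y) * inverse (coeff3 (x, y))
        + - (inverse (coeff3 (x, y)) * (2 * coeff2 (x, y)) * inverse (coeff3 (x, y))) * D (x, y)) (at x)"
      unfolding G_def by (rule DERIV_mult)
    then show ?thesis
    proof (rule DERIV_cong)
      \<comment> \<open>Hence \<open>D\<close> has x-derivative \<open>2 * \<alpha> * D\<close>, the
        same linear equation that \<open>coeff3\<close> satisfies, and the two terms of the product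
        rule cancel.\<close>
      have "x + c1 y = \<alpha> (x, y) * D (x, y)"
        using \<alpha>[OF that] D_nz[OF that] by simp
      then show "2 * (x + c1 y) * inverse (coeff3 (x, y))
          + - (inverse (coeff3 (x, y)) * (2 * coeff2 (x, y)) * inverse (coeff3 (x, y))) * D (x, y) = 0"
        using coeff3[OF that] by (simp add: metric(2)[OF that])
    qed
  qed
  \<comment> \<open>Connectedness of the x-slices turns the pointwise equation into equality across
    the whole slice.\<close>
  then have G_slice: "G (x, y) = G (x', y)" if "(x, y) \<in> U" "(x', y) \<in> U" for x x' y
    by (intro constant_on_connected[of "{x. (x, y) \<in> U}" "\<lambda>x. G (x, y)"])
      (use assms(2) that in \<open>auto simp: has_real_derivative_iff_has_vector_derivative\<close>)
  have A_slice: "coeff1 (x, y) = coeff1 (x', y)" if "(x, y) \<in> U" "(x', y) \<in> U" for x x' y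
    by (intro constant_on_connected[of "{x. (x, y) \<in> U}" "\<lambda>x. coeff1 (x, y)"])
      (use assms(2) that coeff1_slice
        in \<open>auto simp: has_real_derivative_iff_has_vector_derivative\<close>)
  \<comment> \<open>\<open>D\<close> may have either sign, hence the absolute value;
    \<open>G\<close> never vanishes, so the logarithm is smooth.\<close>
  obtain k where k: "smooth_on (snd ` U) k" "\<And>x y. (x, y) \<in> U \<Longrightarrow> ln \<bar>G (x, y)\<bar> = k y"
  proof (rule smooth_on_descend[OF open_U])
    show "smooth_on U (\<lambda>u. ln \<bar>G u\<bar>)"
      by (intro smooth_on_ln_abs open_U smooth_G G_nz)
  qed (auto dest: G_slice)
  obtain g where g: "smooth_on (snd ` U) g" "\<And>x y. (x, y) \<in> U \<Longrightarrow> coeff1 (x, y) = g y"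
    by (rule smooth_on_descend[OF open_U smooth_coeff1 A_slice]) (assumption, assumption, rule that)
  \<comment> \<open>The sign compensates \<open>coeff1 = - a / b\<close>, so that h = (a/b) exp
    k.\<close>
  define h where "h y = (-1) * (g y * exp (k y))" for y
  have "smooth_on (snd ` U) h"
    unfolding h_def
    by (intro smooth_on_mult smooth_on_const smooth_on_exp open_image_snd open_U g k)
  moreover have "a (x, y) = alpha_quotient c1 c2 \<alpha> x y * h y / sqrt (1 + (\<alpha> (x, y))\<^sup>2)"
    "b (x, y) = alpha_quotient c1 c2 \<alpha> x y * exp (k y) / sqrt (1 + (\<alpha> (x, y))\<^sup>2)"
    if xy: "(x, y) \<in> U" for x y
  proof -
    let ?s = "sqrt (1 + (\<alpha> (x, y))\<^sup>2)"
    \<comment> \<open>Where \<open>x + c1 y = 0\<close> this is the chosen extension of the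
      quotient; elsewhere the factor \<bar>x + c1 y\<bar> cancels.\<close>
    have q: "alpha_quotient c1 c2 \<alpha> x y = 1 / \<bar>D (x, y)\<bar>"
      using \<alpha>[OF xy] by (simp add: alpha_quotient_def D_def power2_eq_square abs_divide)
    \<comment> \<open>exp k is \<bar>G\<bar> = \<bar>D\<bar>/\<open>coeff3\<close>, and the
      reciprocal of \<open>coeff3\<close> is \<open>b\<close> times the square root.\<close>
    have e: "exp (k y) = \<bar>D (x, y)\<bar> * (b (x, y) * ?s)"
      using k(2)[OF xy, symmetric] G_nz[OF xy] b[OF xy] s[of "(x, y)"]
      by (simp add: G_def metric(3)[OF xy] abs_mult)
    show "b (x, y) = alpha_quotient c1 c2 \<alpha> x y * exp (k y) / ?s"
      unfolding q e using D_nz[OF xy] s[of "(x, y)"] by simp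
    have "h y = a (x, y) * ?s * \<bar>D (x, y)\<bar>"
      unfolding h_def e g(2)[OF xy, symmetric] metric(1)[OF xy] using b[OF xy] by simp
    then show "a (x, y) = alpha_quotient c1 c2 \<alpha> x y * h y / ?s"
      unfolding q using D_nz[OF xy] s[of "(x, y)"] by simp
  qed
  ultimately show ?thesis
    using k(1) by blast
qed

end
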